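(* Let $w:[0,1]\to\mathbb{R}^+$ be a non-increasing differentiable function (extended to $\mathbb{R}$ by $w(y)=w(0)$ for $y\le0$, $w(y)=w(1)$ for $y\ge1$), and let $R$ be a $k\times k$ doubly stochastic matrix. If $$k>-\frac{w'(1/k)}{w(1/k)},$$ then $\frac1k\mathbf 1$ is a stable equilibrium of the ODE $\dot y=h(y)$, where $h(y)=\frac{\mathbf{w}(y)}{S_w(y)}R-y$.
   Context: $\mathbf 1=(1,\dots,1)\in\mathbb{R}^k$ (row vector). For $y\in\mathbb{R}^k$, $\mathbf{w}(y)=(w(y_1),\dots,w(y_k))$ and $S_w(y)=\sum_i w(y_i)$. $R$ doubly stochastic means nonnegative entries with all row and column sums $1$. An equilibrium $x^*$ of $\dot y=h(y)$ (i.e. $h(x^* )=0$) is called stable if all eigenvalues of the Jacobian matrix of $h$ at $x^*$ have negative real part. *)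

theory Defs
  imports "HOL-Analysis.Analysis"
begin

text \<open>Extension of w from [0,1] to the real line: w(y) = w(0) for y \<le> 0, w(y) = w(1) for y \<ge> 1.\<close>
definition wext :: "(real \<Rightarrow> real) \<Rightarrow> real \<Rightarrow> real" where
  "wext w y = w (max 0 (min 1 y))"

text \<open>The vector field h(y) = w(y) R / S_w(y) - y, with w(y) a row vector multiplied on the left of R.\<close>
definition hfield :: "(real \<Rightarrow> real) \<Rightarrow> real^'k^'k \<Rightarrow> real^'k \<Rightarrow> real^'k" where
  "hfield w R y =
     (let wv = (\<chi> i. wext w (y $ i)); S = (\<Sum>i\<in>UNIV. wext w (y $ i))
      in (1 / S) *\<^sub>R (wv v* R) - y)"

definition doubly_stochastic :: "real^'k^'k \<Rightarrow> bool" where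
  "doubly_stochastic R \<longleftrightarrow>
     (\<forall>i j. 0 \<le> R $ i $ j) \<and>
     (\<forall>i. (\<Sum>j\<in>UNIV. R $ i $ j) = 1) \<and>
     (\<forall>j. (\<Sum>i\<in>UNIV. R $ i $ j) = 1)"

definition is_eigenvalue :: "complex^'n^'n \<Rightarrow> complex \<Rightarrow> bool" where
  "is_eigenvalue A c \<longleftrightarrow> (\<exists>v. v \<noteq> 0 \<and> A *v v = c *s v)"

text \<open>Jacobian matrix of h at x (as a real matrix), and its complexification.\<close>
definition jacobian :: "(real^'n \<Rightarrow> real^'n) \<Rightarrow> real^'n \<Rightarrow> real^'n^'n" where
  "jacobian h x = matrix (frechet_derivative h (at x))"

definition stable_equilibrium :: "(real^'n \<Rightarrow> real^'n) \<Rightarrow> real^'n \<Rightarrow> bool" where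
  "stable_equilibrium h x \<longleftrightarrow>
     h x = 0 \<and> h differentiable (at x) \<and>
     (\<forall>c. is_eigenvalue (\<chi> i j. complex_of_real (jacobian h x $ i $ j)) c \<longrightarrow> Re c < 0)"

end

theory Submission
  imports Defs
begin

text \<open>
  At the uniform point x = (1/k, ..., 1/k) the quotient rule gives the Jacobian
  J = a (R^T - (1/k) 1^T 1) - I with a = w'(1/k) / (k w(1/k)); monotonicity gives a \<le> 0
  and the hypothesis on k gives a > -1. Let J v = \<lambda> v. If the coordinates of v have nonzero sum,
  summing the equations and using the row sums of R gives \<lambda> = -1. Otherwise
  (\<lambda> + 1) v = a R^T v, and since R^T does not increase the maximum norm
  (R is nonnegative with column sums 1), |\<lambda> + 1| \<le> |a| < 1. Either way Re \<lambda> < 0.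
\<close>

lemma has_derivative_vec_nth_iff:
  fixes f :: "'a::real_normed_vector \<Rightarrow> real^'n"
  shows "(f has_derivative f') (at x within S) \<longleftrightarrow>
    (\<forall>j. ((\<lambda>y. f y $ j) has_derivative (\<lambda>v. f' v $ j)) (at x within S))"
  unfolding has_derivative_componentwise_within[of f] by (simp add: Basis_vec_def inner_axis)

lemma antimono_imp_deriv_nonpos:
  fixes f :: "real \<Rightarrow> real"
  assumes "\<forall>x\<in>A. \<forall>y\<in>A. x \<le> y \<longrightarrow> f y \<le> f x"
    and "(f has_real_derivative D) (at x)" and "x \<in> interior A"
  shows "D \<le> 0"
proof -
  have "mono_on A (\<lambda>x. - f x)"
    using assms(1) by (auto intro: mono_onI)
  moreover have "((\<lambda>x. - f x) has_real_derivative - D) (at x)"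
    using assms(2) by (rule DERIV_minus)
  ultimately have "- D \<ge> 0"
    using assms(3) by (rule mono_on_imp_deriv_nonneg)
  then show ?thesis
    by simp
qed

lemma norm_le_if_column_stochastic_eigen:
  fixes R :: "real^'k^'k" and v :: "complex^'k"
  assumes nonneg: "\<forall>i j. 0 \<le> R $ i $ j" and cols: "\<forall>j. (\<Sum>i\<in>UNIV. R $ i $ j) = 1"
    and "v \<noteq> 0" and eigen: "\<forall>j. \<mu> * v $ j = a * (\<Sum>i\<in>UNIV. R $ i $ j * v $ i)"
  shows "norm \<mu> \<le> \<bar>a\<bar>"
proof -
  define m where "m = Max (range (\<lambda>i. norm (v $ i)))"
  have "m \<in> range (\<lambda>i. norm (v $ i))"
    unfolding m_def by (rule Max_in) auto
  then obtain j where "norm (v $ j) = m"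
    by auto
  then have max: "norm (v $ i) \<le> norm (v $ j)" for i
    unfolding m_def by (auto intro: Max_ge)
  have "v $ j \<noteq> 0"
  proof
    assume "v $ j = 0"
    then have "v = 0"
      using max by (simp add: vec_eq_iff)
    with \<open>v \<noteq> 0\<close> show False ..
  qed
  have "norm (\<Sum>i\<in>UNIV. R $ i $ j * v $ i) \<le> (\<Sum>i\<in>UNIV. R $ i $ j * norm (v $ j))"
    by (rule order.trans[OF norm_sum sum_mono]) (simp add: norm_mult nonneg max mult_left_mono)
  also have "\<dots> = norm (v $ j)"
    using cols by (simp flip: sum_distrib_right)
  finally have "norm (a * (\<Sum>i\<in>UNIV. R $ i $ j * v $ i)) \<le> \<bar>a\<bar> * norm (v $ j)"
    by (simp add: norm_mult mult_left_mono)
  then have "norm \<mu> * norm (v $ j) \<le> \<bar>a\<bar> * norm (v $ j)"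
    by (simp flip: eigen add: norm_mult)
  then show ?thesis
    using \<open>v $ j \<noteq> 0\<close> by simp
qed

definition hfield_linearization :: "real \<Rightarrow> real^'k^'k \<Rightarrow> real^'k^'k" where
  "hfield_linearization a R = a *\<^sub>R (transpose R - (\<chi> i j. 1 / real CARD('k))) - mat 1"

lemma hfield_linearization_mult_nth:
  fixes R :: "real^'k^'k" and v :: "'a::real_field^'k"
  shows "((\<chi> i j. of_real (hfield_linearization a R $ i $ j)) *v v) $ j =
    of_real a * ((\<Sum>i\<in>UNIV. of_real (R $ i $ j) * v $ i) - (\<Sum>i\<in>UNIV. v $ i) / of_nat CARD('k))
    - v $ j"
  by (simp add: hfield_linearization_def transpose_def mat_def matrix_vector_mult_def
      algebra_simps sum.distrib sum_subtractf sum_distrib_left sum_divide_distrib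
      if_distrib[of of_real] if_distrib[where f="\<lambda>x. _ * x"] cong: if_cong)

lemma hfield_linearization_mult_nth_real:
  fixes R :: "real^'k^'k"
  shows "(hfield_linearization a R *v v) $ j =
    a * ((\<Sum>i\<in>UNIV. R $ i $ j * v $ i) - (\<Sum>i\<in>UNIV. v $ i) / real CARD('k)) - v $ j"
  using hfield_linearization_mult_nth[where 'a=real] by simp

lemma eigenvalue_hfield_linearization_Re_neg:
  fixes R :: "real^'k^'k"
  assumes ds: "doubly_stochastic R" and "\<bar>a\<bar> < 1"
    and "is_eigenvalue (\<chi> i j. complex_of_real (hfield_linearization a R $ i $ j)) l"
  shows "Re l < 0"
proof -
  obtain v where "v \<noteq> 0"
    and "(\<chi> i j. complex_of_real (hfield_linearization a R $ i $ j)) *v v = l *s v"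
    using assms(3) unfolding is_eigenvalue_def by blast
  then have eigen: "l * v $ j =
      a * ((\<Sum>i\<in>UNIV. R $ i $ j * v $ i) - (\<Sum>i\<in>UNIV. v $ i) / CARD('k)) - v $ j" for j
    by (simp flip: hfield_linearization_mult_nth)
  have rows: "\<forall>i. (\<Sum>j\<in>UNIV. R $ i $ j) = 1" and cols: "\<forall>j. (\<Sum>i\<in>UNIV. R $ i $ j) = 1"
    and nonneg: "\<forall>i j. 0 \<le> R $ i $ j"
    using ds unfolding doubly_stochastic_def by auto
  define s where "s = (\<Sum>i\<in>UNIV. v $ i)"
  show ?thesis
  proof (cases "s = 0")
    case True
    then have "\<forall>j. (l + 1) * v $ j = a * (\<Sum>i\<in>UNIV. R $ i $ j * v $ i)"
      using eigen by (simp add: algebra_simps s_def)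
    then have "norm (l + 1) \<le> \<bar>a\<bar>"
      using norm_le_if_column_stochastic_eigen nonneg cols \<open>v \<noteq> 0\<close> by blast
    then show ?thesis
      using complex_Re_le_cmod[of "l + 1"] \<open>\<bar>a\<bar> < 1\<close> by simp
  next
    case False
    have "l * s = (\<Sum>j\<in>UNIV. a * ((\<Sum>i\<in>UNIV. R $ i $ j * v $ i) - s / CARD('k)) - v $ j)"
      by (simp add: s_def sum_distrib_left eigen)
    also have "\<dots> = a * ((\<Sum>j\<in>UNIV. \<Sum>i\<in>UNIV. R $ i $ j * v $ i) - CARD('k) * (s / CARD('k))) - s"
      by (simp add: sum_subtractf s_def flip: sum_distrib_left)
    also have "(\<Sum>j\<in>UNIV. \<Sum>i\<in>UNIV. R $ i $ j * v $ i) = s"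
      using rows by (subst sum.swap) (simp add: s_def flip: sum_distrib_right of_real_sum)
    also have "a * (s - CARD('k) * (s / CARD('k))) - s = - s"
      by simp
    finally have "l * s = - s" .
    then have "l = -1"
      using False by (metis mult_cancel_right mult_minus1)
    then show ?thesis
      by simp
  qed
qed

lemma wext_pos:
  assumes "\<forall>x\<in>{0..1}. w x > 0"
  shows "wext w y > 0"
  using assms by (simp add: wext_def)

lemma wext_has_real_derivative:
  assumes "(w has_real_derivative d) (at x)" and "x \<in> {0<..<1}"
  shows "(wext w has_real_derivative d) (at x)"
  using assms(1) _ assms(2) by (rule has_field_derivative_transform_within_open) (auto simp: wext_def)

lemma hfield_nth:
  "hfield w R y $ j = (\<Sum>i\<in>UNIV. R $ i $ j * wext w (y $ i)) / (\<Sum>i\<in>UNIV. wext w (y $ i)) - y $ j"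
  by (simp add: hfield_def Let_def vector_matrix_mult_def mult.commute)

lemma hfield_uniform_eq_0:
  fixes R :: "real^'k^'k"
  assumes "\<forall>j. (\<Sum>i\<in>UNIV. R $ i $ j) = 1" and "wext w (1 / real CARD('k)) \<noteq> 0"
  shows "hfield w R (\<chi> i. 1 / real CARD('k)) = 0"
  using assms by (simp add: vec_eq_iff hfield_nth flip: sum_distrib_right)

lemma hfield_card_1:
  fixes R :: "real^'k^'k"
  assumes "CARD('k) = 1" and "\<forall>j. (\<Sum>i\<in>UNIV. R $ i $ j) = 1" and "\<forall>t. wext w t \<noteq> 0"
  shows "hfield w R y = 1 - y"
proof -
  obtain k :: 'k where UNIV: "UNIV = {k}"
    using assms(1) card_1_singletonE by blast
  show ?thesis
    using assms(2,3) by (simp add: vec_eq_iff hfield_nth UNIV)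
qed

lemma hfield_has_derivative_at_uniform:
  fixes R :: "real^'k^'k"
  defines "n \<equiv> real CARD('k)"
  assumes cols: "\<forall>j. (\<Sum>i\<in>UNIV. R $ i $ j) = 1" and pos: "wext w (1 / n) > 0"
    and deriv: "(wext w has_real_derivative d) (at (1 / n))"
  shows "(hfield w R has_derivative (*v) (hfield_linearization (d / (n * wext w (1 / n))) R))
    (at (\<chi> i. 1 / n))"
  unfolding has_derivative_vec_nth_iff
proof
  fix j
  let ?x = "\<chi> i. 1 / n :: real^'k"
  define c where "c = wext w (1 / n)"
  have wi: "((\<lambda>y. wext w (y $ i)) has_derivative (\<lambda>v. d * v $ i)) (at ?x)" for i
  proof -
    have "((\<lambda>y. y $ i) has_derivative (\<lambda>v. v $ i)) (at ?x)"
      by (rule bounded_linear_imp_has_derivative[OF bounded_linear_vec_nth])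
    moreover have "(wext w has_derivative (*) d) (at (?x $ i))"
      using deriv by (simp add: has_field_derivative_def)
    ultimately show ?thesis
      by (rule has_derivative_compose)
  qed
  have "((\<lambda>y. hfield w R y $ j) has_derivative (\<lambda>v.
      (d * (\<Sum>i\<in>UNIV. R $ i $ j * v $ i) * (n * c) - c * (d * (\<Sum>i\<in>UNIV. v $ i))) / (n * c * (n * c))
      - v $ j)) (at ?x)"
    unfolding hfield_nth
    using pos cols
    by (auto intro!: derivative_eq_intros wi[unfolded n_def]
        bounded_linear_imp_has_derivative[OF bounded_linear_vec_nth]
        simp: c_def n_def sum_distrib_left mult.left_commute simp flip: sum_distrib_right)
  then show "((\<lambda>y. hfield w R y $ j) has_derivative
      (\<lambda>v. (hfield_linearization (d / (n * c)) R *v v) $ j)) (at ?x)"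
  proof (rule has_derivative_eq_rhs)
    have "n > 0" "c > 0"
      using pos by (simp_all add: n_def c_def)
    then show "(\<lambda>v. (d * (\<Sum>i\<in>UNIV. R $ i $ j * v $ i) * (n * c) - c * (d * (\<Sum>i\<in>UNIV. v $ i)))
        / (n * c * (n * c)) - v $ j) = (\<lambda>v. (hfield_linearization (d / (n * c)) R *v v) $ j)"
      by (simp add: fun_eq_iff hfield_linearization_mult_nth_real n_def field_simps)
  qed
qed

lemma hfield_linearizable_at_uniform:
  fixes R :: "real^'k^'k"
  assumes pos: "\<forall>x\<in>{0..1}. w x > 0"
    and noninc: "\<forall>x\<in>{0..1}. \<forall>y\<in>{0..1}. x \<le> y \<longrightarrow> w y \<le> w x"
    and deriv: "\<forall>x\<in>{0..1}. (w has_real_derivative w' x) (at x within {0..1})"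
    and cols: "\<forall>j. (\<Sum>i\<in>UNIV. R $ i $ j) = 1"
    and cond: "real CARD('k) > - w' (1 / real CARD('k)) / w (1 / real CARD('k))"
  obtains a where "\<bar>a\<bar> < 1"
    and "(hfield w R has_derivative (*v) (hfield_linearization a R)) (at (\<chi> i. 1 / real CARD('k)))"
proof (cases "CARD('k) = 1")
  case True
  \<comment> \<open>Then 1/k = 1 is an endpoint where wext w need not be differentiable, but h does not depend on w.\<close>
  have "((\<lambda>y. 1 - y) has_derivative (\<lambda>v. - v)) (at (\<chi> i. 1 / real CARD('k)))"
    by (auto intro!: derivative_eq_intros)
  moreover have "(*v) (hfield_linearization 0 R) = (\<lambda>v. - v)"
    by (simp add: fun_eq_iff vec_eq_iff hfield_linearization_mult_nth_real)
  moreover have "hfield w R = (\<lambda>y. 1 - y)"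
    using hfield_card_1[OF True cols] wext_pos[OF pos] by (metis less_irrefl)
  ultimately have "(hfield w R has_derivative (*v) (hfield_linearization 0 R)) (at (\<chi> i. 1 / real CARD('k)))"
    by simp
  then show ?thesis
    by (rule that[rotated]) simp
next
  case False
  let ?n = "real CARD('k)"
  have "CARD('k) > 1"
    using False by (simp add: nat_neq_iff)
  then have c: "1 / ?n \<in> {0<..<1}"
    by simp
  then have "(w has_real_derivative w' (1 / ?n)) (at (1 / ?n) within {0..1})"
    using deriv by simp
  then have "(w has_real_derivative w' (1 / ?n)) (at (1 / ?n))"
    using c by (simp add: at_within_Icc_at)
  then have wext_deriv: "(wext w has_real_derivative w' (1 / ?n)) (at (1 / ?n))"
    and "w' (1 / ?n) \<le> 0"
    using c by (auto intro: wext_has_real_derivative antimono_imp_deriv_nonpos[OF noninc])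
  moreover have "w (1 / ?n) > 0" "wext w (1 / ?n) = w (1 / ?n)"
    using pos c by (simp_all add: wext_def)
  ultimately have "\<bar>w' (1 / ?n) / (?n * wext w (1 / ?n))\<bar> < 1"
    using cond by (simp add: abs_if field_simps)
  with hfield_has_derivative_at_uniform[OF cols wext_pos[OF pos] wext_deriv] show ?thesis
    using that by blast
qed

theorem corollary2:
  fixes w w' :: "real \<Rightarrow> real" and R :: "real^'k^'k"
  assumes pos: "\<forall>x\<in>{0..1}. w x > 0"
    and noninc: "\<forall>x\<in>{0..1}. \<forall>y\<in>{0..1}. x \<le> y \<longrightarrow> w y \<le> w x"
    and deriv: "\<forall>x\<in>{0..1}. (w has_real_derivative w' x) (at x within {0..1})"
    and ds: "doubly_stochastic R"
    and cond: "real CARD('k) > - w' (1 / real CARD('k)) / w (1 / real CARD('k))"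
  shows "stable_equilibrium (hfield w R) (\<chi> i. 1 / real CARD('k))"
proof -
  let ?x = "\<chi> i. 1 / real CARD('k)"
  have cols: "\<forall>j. (\<Sum>i\<in>UNIV. R $ i $ j) = 1"
    using ds unfolding doubly_stochastic_def by blast
  obtain a where "\<bar>a\<bar> < 1"
    and lin: "(hfield w R has_derivative (*v) (hfield_linearization a R)) (at ?x)"
    using hfield_linearizable_at_uniform[OF pos noninc deriv cols cond] by blast
  have "jacobian (hfield w R) ?x = hfield_linearization a R"
    unfolding jacobian_def frechet_derivative_at[OF lin, symmetric] by simp
  moreover have "hfield w R ?x = 0"
    by (intro hfield_uniform_eq_0[OF cols]) (metis wext_pos[OF pos] less_irrefl)
  ultimately show ?thesis
    using lin eigenvalue_hfield_linearization_Re_neg[OF ds \<open>\<bar>a\<bar> < 1\<close>]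
    unfolding stable_equilibrium_def by (auto intro: differentiableI)
qed

end
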